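(* Fix positive integers $n,m\ge 2$ and, for $i=1,\ldots,n$, let $\{\mu_{ij}\}_{j=1}^m$ be a sequence of real numbers such that $1>\mu_{i1}\ge\cdots\ge\mu_{im}>0$ and for which the class $\mathcal{B}(\mu_{i1},\ldots,\mu_{im})$ is non-empty. Let $X_1,\ldots,X_n$ be independent random variables such that $X_i\in\mathcal{B}(\mu_{i1},\ldots,\mu_{im})$ for $i=1,\ldots,n$, and fix $t\in[0,n]$. Then $$\mathbb{P}\left[\sum_{i=1}^n X_i\ge t\right]\le\inf_{f\in\mathcal{F}_{sic}}\frac{1}{f(t)}\left\{\mathbb{E}[f(T_{nm})]\right\}^n,$$ where $T_{nm}$ is the random variable that takes on values in the set $\{\frac0m,\frac1m,\ldots,\frac mm\}$ and, for $j=0,1,\ldots,m$, satisfies $$\mathbb{P}\left[T_{nm}=\frac jm\right]=\frac1n\sum_{i=1}^n\binom mj\mathbb{E}\left[X_i^j(1-X_i)^{m-j}\right].$$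
   Context: For $\mu_1,\ldots,\mu_m\in(0,1)$, $\mathcal{B}(\mu_1,\ldots,\mu_m)$ is the class of all random variables $X$ with $0\le X\le1$ and $\mathbb{E}[X^j]=\mu_j$ for $j=1,\ldots,m$. A function $f:[0,+\infty)\to[0,+\infty)$ is sub-multiplicative if $f(x+y)\le f(x)f(y)$ for all $x,y\ge0$. $\mathcal{F}_{sic}$ denotes the set of all functions $f:[0,+\infty)\to[0,+\infty)$ that are sub-multiplicative, increasing (in the sense of nondecreasing) and convex. The infimum is over those $f\in\mathcal{F}_{sic}$ with $f(t)>0$. *)

theory Defs
  imports "HOL-Probability.Probability"
begin

(* The class B(mu 1, ..., mu m), restricted to random variables living on M.  The bounds are
   required almost surely, so that membership depends only on the law of X. *)
definition moment_class :: "'a measure \<Rightarrow> nat \<Rightarrow> (nat \<Rightarrow> real) \<Rightarrow> ('a \<Rightarrow> real) set" where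
  "moment_class M m \<mu> =
     {X \<in> borel_measurable M.
        (AE \<omega> in M. 0 \<le> X \<omega> \<and> X \<omega> \<le> 1) \<and>
        (\<forall>j\<in>{1..m}. (\<integral>\<omega>. X \<omega> ^ j \<partial>M) = \<mu> j)}"

(* Non-emptiness of the class over all probability spaces.  It suffices to range over
   probability measures on the type of reals: a random variable in the class can be replaced by
   the identity on its law. *)
definition moment_class_nonempty :: "nat \<Rightarrow> (nat \<Rightarrow> real) \<Rightarrow> bool" where
  "moment_class_nonempty m \<mu> \<longleftrightarrow>
     (\<exists>M :: real measure. prob_space M \<and> moment_class M m \<mu> \<noteq> {})"

definition sub_multiplicative :: "(real \<Rightarrow> real) \<Rightarrow> bool" where
  "sub_multiplicative f \<longleftrightarrow> (\<forall>x\<ge>0. \<forall>y\<ge>0. f (x + y) \<le> f x * f y)"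

(* A function from [0, oo) to [0, oo) is represented by a total function whose values on the
   negative reals are irrelevant. *)
definition F_sic :: "(real \<Rightarrow> real) set" where
  "F_sic = {f \<in> {0..} \<rightarrow> {0..}. sub_multiplicative f \<and> mono_on {0..} f \<and> convex_on {0..} f}"

end

theory Submission
  imports Defs
begin

text \<open>
  The proof is the exponential-moment method with a function \<open>f \<in> F_sic\<close> in place of the
  exponential.  Write \<open>S\<close> for the sum of the \<open>X\<^sub>i\<close>.  Monotonicity of \<open>f\<close> and Markov's inequality bound the
  tail of \<open>S\<close> by \<open>E[f(S)] / f(t)\<close>.  Sub-multiplicativity (\<open>sub_multiplicative_sum_le_prod\<close>) then
  does the work of \<open>exp (x + y) = exp x * exp y\<close>: it bounds \<open>f(S)\<close> by the product of the \<open>f(X\<^sub>i)\<close>, whose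
  expectation factors by independence.

  The moments enter through convexity.  A point \<open>x\<close> of the unit interval is the mean of the
  distribution that puts the binomial weight \<open>Bernstein m j x\<close> on \<open>j / m\<close>, so Jensen's inequality
  bounds \<open>f(x)\<close> by the value at \<open>x\<close> of the Bernstein polynomial of \<open>f\<close>
  (\<open>convex_on_le_Bernstein_sum\<close>).  Taking expectations replaces \<open>E[f(X\<^sub>i)]\<close> by the mean \<open>a\<^sub>i\<close> of \<open>f\<close>
  under the mixture of these binomial distributions over the law of \<open>X\<^sub>i\<close>.  By the
  inequality of arithmetic and geometric means, the product of the \<open>a\<^sub>i\<close> is at most the \<open>n\<close>th power
  of their average.  The law of \<open>T\<close> is the average of those \<open>n\<close> mixtures, so this average is \<open>E[f(T)]\<close>.
\<close>

text \<open>
  Non-emptiness matters: the empty product is 1, whereas \<open>f 0 = 0\<close> is possible when \<open>f\<close> vanishes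
  identically.
\<close>
lemma sub_multiplicative_sum_le_prod:
  fixes x :: "'i \<Rightarrow> real"
  assumes sm: "sub_multiplicative f" and f0: "\<And>y. y \<ge> 0 \<Longrightarrow> f y \<ge> 0"
    and "finite I" "I \<noteq> {}" "\<And>i. i \<in> I \<Longrightarrow> x i \<ge> 0"
  shows "f (\<Sum>i\<in>I. x i) \<le> (\<Prod>i\<in>I. f (x i))"
  using assms(3-)
proof (induction I rule: finite_ne_induct)
  case (insert i I)
  have "f (\<Sum>i\<in>insert i I. x i) = f (x i + (\<Sum>i\<in>I. x i))"
    using insert.hyps by simp
  also have "\<dots> \<le> f (x i) * f (\<Sum>i\<in>I. x i)"
    using sm insert.prems unfolding sub_multiplicative_def by (simp add: sum_nonneg)
  also have "\<dots> \<le> f (x i) * (\<Prod>i\<in>I. f (x i))"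
    using insert f0 by (intro mult_left_mono) auto
  finally show ?case using insert.hyps by simp
qed simp

text \<open>
  A binomial variable with parameters \<open>m\<close> and \<open>x\<close>, divided by \<open>m\<close>, has mean \<open>x\<close>; this is Jensen's
  inequality for it.
\<close>
lemma convex_on_le_Bernstein_sum:
  assumes f: "convex_on {0..1} f" and x: "x \<in> {0..1}" and m: "m > 0"
  shows "f x \<le> (\<Sum>j\<le>m. Bernstein m j x * f (real j / real m))"
proof -
  have "(\<Sum>j\<le>m. Bernstein m j x *\<^sub>R (real j / real m)) = (\<Sum>j\<le>m. real j * Bernstein m j x) / real m"
    by (simp add: sum_divide_distrib mult.commute del: sum_k_Bernstein)
  also have "\<dots> = x" unfolding sum_k_Bernstein using m by simp
  finally have mean: "(\<Sum>j\<le>m. Bernstein m j x *\<^sub>R (real j / real m)) = x" .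
  have "f (\<Sum>j\<le>m. Bernstein m j x *\<^sub>R (real j / real m)) \<le> (\<Sum>j\<le>m. Bernstein m j x * f (real j / real m))"
    using x m by (intro convex_on_sum[OF _ _ f]) (auto simp: Bernstein_nonneg)
  then show ?thesis by (simp only: mean)
qed

lemma prod_le_mean_power:
  fixes a :: "'i \<Rightarrow> real"
  assumes "finite I" "I \<noteq> {}" and a: "\<And>i. i \<in> I \<Longrightarrow> a i \<ge> 0"
  shows "(\<Prod>i\<in>I. a i) \<le> ((\<Sum>i\<in>I. a i) / card I) ^ card I"
proof -
  let ?n = "card I"
  have n: "?n > 0" using assms by (simp add: card_gt_0_iff)
  have P: "(\<Prod>i\<in>I. a i) \<ge> 0" by (intro prod_nonneg) (use a in auto)
  have "(\<Prod>i\<in>I. a i) = ((\<Prod>i\<in>I. a i) powr (1 / ?n)) ^ ?n"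
    using n P by (cases "(\<Prod>i\<in>I. a i) = 0") (simp_all add: powr_power)
  also have "\<dots> \<le> (\<Sum>i\<in>I. a i / ?n) ^ ?n"
    using arith_geom_mean[OF assms] by (intro power_mono) auto
  finally show ?thesis by (simp add: sum_divide_distrib)
qed

lemma (in prob_space) expectation_finite_range:
  fixes f :: "'b::t1_space \<Rightarrow> real"
  assumes [measurable]: "T \<in> borel_measurable M"
    and "finite J" and inj: "inj_on v J" and range: "\<And>\<omega>. \<omega> \<in> space M \<Longrightarrow> T \<omega> \<in> v ` J"
  shows "expectation (\<lambda>\<omega>. f (T \<omega>)) = (\<Sum>j\<in>J. f (v j) * prob {\<omega>\<in>space M. T \<omega> = v j})"
proof -
  let ?A = "\<lambda>j. {\<omega>\<in>space M. T \<omega> = v j}"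
  have meas: "?A j \<in> events" for j
  proof -
    have "T -` {v j} \<inter> space M \<in> events" by (intro measurable_sets[OF assms(1)]) auto
    then show ?thesis by (simp add: vimage_def Int_def conj_commute)
  qed
  have "f (T \<omega>) = (\<Sum>j\<in>J. f (v j) * indicator (?A j) \<omega>)" if "\<omega> \<in> space M" for \<omega>
  proof -
    from range[OF that] obtain k where k: "k \<in> J" "T \<omega> = v k" by auto
    have "(\<Sum>j\<in>J. f (v j) * indicator (?A j) \<omega>) = (\<Sum>j\<in>J. if j = k then f (v k) else 0)"
      using k inj that by (intro sum.cong) (auto simp: indicator_def dest: inj_onD)
    then show ?thesis using k \<open>finite J\<close> by simp
  qed
  then have "expectation (\<lambda>\<omega>. f (T \<omega>)) = expectation (\<lambda>\<omega>. \<Sum>j\<in>J. f (v j) * indicator (?A j) \<omega>)"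
    by (intro Bochner_Integration.integral_cong) auto
  also have "\<dots> = (\<Sum>j\<in>J. f (v j) * prob (?A j))"
    using meas by (subst Bochner_Integration.integral_sum)
      (auto intro!: integrable_mult_right integrable_real_indicator simp: emeasure_eq_measure)
  finally show ?thesis .
qed

text \<open>
  The bound for a single \<open>f\<close>, with \<open>E[f(T)]\<close> written out in terms of the \<open>X\<^sub>i\<close>.
\<close>
lemma (in prob_space) tail_le_Bernstein_mean_power:
  fixes X :: "'i \<Rightarrow> 'a \<Rightarrow> real"
  assumes I: "finite I" "I \<noteq> {}" and indep: "indep_vars (\<lambda>_. borel) X I"
    and bounds: "\<And>i. i \<in> I \<Longrightarrow> AE \<omega> in M. 0 \<le> X i \<omega> \<and> X i \<omega> \<le> 1"
    and f: "f \<in> F_sic" and t: "t \<ge> 0" "f t > 0" and m: "m > 0"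
  shows "prob {\<omega>\<in>space M. (\<Sum>i\<in>I. X i \<omega>) \<ge> t} \<le>
    1 / f t * ((\<Sum>i\<in>I. \<Sum>j\<le>m. f (real j / real m) * expectation (\<lambda>\<omega>. Bernstein m j (X i \<omega>))) / card I) ^ card I"
proof -
  have f0: "f x \<ge> 0" if "x \<ge> 0" for x using f that by (auto simp: F_sic_def)
  have sm: "sub_multiplicative f" and mono: "mono_on {0..} f" and conv: "convex_on {0..} f"
    using f by (auto simp: F_sic_def)
  have [measurable]: "random_variable borel (X i)" if "i \<in> I" for i
    using indep that by (auto simp: indep_vars_def)
  \<comment> \<open>Nothing is known of \<open>f\<close> on the negative reals, and \<open>f\<close> need not be bounded.  Clamping the
    argument to the unit interval gives a bounded monotone, hence Borel, function that agrees with
    \<open>f\<close> wherever the \<open>X\<^sub>i\<close> almost surely take their values.\<close>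
  define g where "g x = f (max 0 (min 1 x))" for x
  have "mono g"
    unfolding g_def by (intro monoI mono_onD[OF mono]) auto
  then have g_meas[measurable]: "g \<in> borel_measurable borel" by (rule borel_measurable_mono)
  have g0: "g x \<ge> 0" for x by (simp add: g_def f0)
  have g1: "g x \<le> f 1" for x unfolding g_def by (intro mono_onD[OF mono]) auto
  have g_eq: "g x = f x" if "0 \<le> x" "x \<le> 1" for x using that by (simp add: g_def)
  have int_g: "integrable M (\<lambda>\<omega>. g (X i \<omega>))" if "i \<in> I" for i
    using that g0 g1 by (intro integrable_const_bound[where B = "f 1"]) auto
  have indep_g: "indep_vars (\<lambda>_. borel) (\<lambda>i \<omega>. g (X i \<omega>)) I"
    by (rule indep_vars_compose2[OF indep]) simp
  have int_prod: "integrable M (\<lambda>\<omega>. \<Prod>i\<in>I. g (X i \<omega>))"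
    by (rule indep_vars_integrable[OF I(1) indep_g int_g])
  have int_B: "integrable M (\<lambda>\<omega>. Bernstein m j (X i \<omega>))" if "i \<in> I" for i j
  proof (rule integrable_const_bound)
    show "AE \<omega> in M. norm (Bernstein m j (X i \<omega>)) \<le> real (m choose j)"
      using bounds[OF that]
    proof eventually_elim
      case (elim \<omega>)
      then show ?case
        unfolding Bernstein_def
        by (auto simp: abs_mult mult.assoc power_abs power_le_one mult_le_one intro!: mult_left_le)
    qed
    show "random_variable borel (\<lambda>\<omega>. Bernstein m j (X i \<omega>))"
      using that unfolding Bernstein_def by measurable
  qed
  have AE_bounds: "AE \<omega> in M. \<forall>i\<in>I. 0 \<le> X i \<omega> \<and> X i \<omega> \<le> 1"
    using bounds I by (intro AE_finite_allI) auto

  have "prob {\<omega>\<in>space M. (\<Sum>i\<in>I. X i \<omega>) \<ge> t} \<le> prob {\<omega>\<in>space M. (\<Prod>i\<in>I. g (X i \<omega>)) \<ge> f t}"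
  proof (rule finite_measure_mono_AE)
    show "AE \<omega> in M. \<omega> \<in> {\<omega>\<in>space M. (\<Sum>i\<in>I. X i \<omega>) \<ge> t} \<longrightarrow>
        \<omega> \<in> {\<omega>\<in>space M. (\<Prod>i\<in>I. g (X i \<omega>)) \<ge> f t}"
      using AE_bounds
    proof eventually_elim
      case (elim \<omega>)
      have "f t \<le> (\<Prod>i\<in>I. g (X i \<omega>))" if "t \<le> (\<Sum>i\<in>I. X i \<omega>)"
      proof -
        have "f t \<le> f (\<Sum>i\<in>I. X i \<omega>)" using mono_onD[OF mono, of t] t that by auto
        also have "\<dots> \<le> (\<Prod>i\<in>I. f (X i \<omega>))"
          by (rule sub_multiplicative_sum_le_prod[OF sm f0 I]) (use elim in auto)
        also have "\<dots> = (\<Prod>i\<in>I. g (X i \<omega>))"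
          using elim by (intro prod.cong) (auto simp: g_eq)
        finally show ?thesis .
      qed
      then show ?case by auto
    qed
    show "{\<omega>\<in>space M. (\<Prod>i\<in>I. g (X i \<omega>)) \<ge> f t} \<in> events"
      using int_prod by measurable
  qed
  also have "\<dots> \<le> expectation (\<lambda>\<omega>. \<Prod>i\<in>I. g (X i \<omega>)) / f t"
    using g0 t by (intro integral_Markov_inequality_measure[OF int_prod sets.empty_sets])
      (auto intro: prod_nonneg)
  also have "\<dots> = 1 / f t * (\<Prod>i\<in>I. expectation (\<lambda>\<omega>. g (X i \<omega>)))"
    by (simp add: indep_vars_lebesgue_integral[OF I(1) indep_g int_g])
  also have "\<dots> \<le> 1 / f t * (\<Prod>i\<in>I. \<Sum>j\<le>m. f (real j / real m) * expectation (\<lambda>\<omega>. Bernstein m j (X i \<omega>)))"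
  proof (intro mult_left_mono prod_mono conjI)
    fix i assume i: "i \<in> I"
    show "0 \<le> expectation (\<lambda>\<omega>. g (X i \<omega>))" by (simp add: g0)
    have "expectation (\<lambda>\<omega>. g (X i \<omega>)) \<le>
        expectation (\<lambda>\<omega>. \<Sum>j\<le>m. f (real j / real m) * Bernstein m j (X i \<omega>))"
    proof (rule integral_mono_AE[OF int_g[OF i]])
      show "integrable M (\<lambda>\<omega>. \<Sum>j\<le>m. f (real j / real m) * Bernstein m j (X i \<omega>))"
        using int_B[OF i] by auto
      show "AE \<omega> in M. g (X i \<omega>) \<le> (\<Sum>j\<le>m. f (real j / real m) * Bernstein m j (X i \<omega>))"
        using bounds[OF i]
      proof eventually_elim
        case (elim \<omega>)
        have "convex_on {0..1} f" using conv by (rule convex_on_subset) auto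
        from convex_on_le_Bernstein_sum[OF this _ m, of "X i \<omega>"] elim
        show ?case by (simp add: g_eq mult.commute)
      qed
    qed
    also have "\<dots> = (\<Sum>j\<le>m. f (real j / real m) * expectation (\<lambda>\<omega>. Bernstein m j (X i \<omega>)))"
      using int_B[OF i] by simp
    finally show "expectation (\<lambda>\<omega>. g (X i \<omega>)) \<le>
      (\<Sum>j\<le>m. f (real j / real m) * expectation (\<lambda>\<omega>. Bernstein m j (X i \<omega>)))" .
  qed (use t in simp)
  also have "\<dots> \<le> 1 / f t * ((\<Sum>i\<in>I. \<Sum>j\<le>m. f (real j / real m) *
      expectation (\<lambda>\<omega>. Bernstein m j (X i \<omega>))) / card I) ^ card I"
  proof (intro mult_left_mono prod_le_mean_power I sum_nonneg mult_nonneg_nonneg)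
    fix i j assume i: "i \<in> I"
    show "0 \<le> expectation (\<lambda>\<omega>. Bernstein m j (X i \<omega>))"
    proof (rule integral_nonneg_AE)
      show "AE \<omega> in M. 0 \<le> Bernstein m j (X i \<omega>)"
        using bounds[OF i] by eventually_elim (simp add: Bernstein_nonneg)
    qed
  qed (use t f0 in simp_all)
  finally show ?thesis .
qed

lemma const_1_in_F_sic: "(\<lambda>_. 1) \<in> F_sic"
  by (auto simp: F_sic_def sub_multiplicative_def mono_on_def convex_on_const)

theorem theorem1p9:
  fixes M :: "'a measure" and N :: "'b measure"
    and X :: "nat \<Rightarrow> 'a \<Rightarrow> real" and T :: "'b \<Rightarrow> real"
    and \<mu> :: "nat \<Rightarrow> nat \<Rightarrow> real" and n m :: nat and t :: real
  assumes "n \<ge> 2" and "m \<ge> 2"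
    and "\<forall>i\<in>{1..n}. 1 > \<mu> i 1 \<and> (\<forall>j\<in>{1..<m}. \<mu> i j \<ge> \<mu> i (j + 1)) \<and> \<mu> i m > 0"
    and "\<forall>i\<in>{1..n}. moment_class_nonempty m (\<mu> i)"
    and "prob_space M"
    and "prob_space.indep_vars M (\<lambda>_. borel) X {1..n}"
    and "\<forall>i\<in>{1..n}. X i \<in> moment_class M m (\<mu> i)"
    and "t \<in> {0..real n}"
    and "prob_space N"
    and "T \<in> borel_measurable N"
    and "\<forall>\<omega>\<in>space N. T \<omega> \<in> (\<lambda>j. real j / real m) ` {0..m}"
    and "\<forall>j\<in>{0..m}. measure N {\<omega>\<in>space N. T \<omega> = real j / real m} =
           1 / real n * (\<Sum>i=1..n. real (m choose j) * (\<integral>\<omega>. X i \<omega> ^ j * (1 - X i \<omega>) ^ (m - j) \<partial>M))"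
  shows "measure M {\<omega>\<in>space M. (\<Sum>i=1..n. X i \<omega>) \<ge> t}
           \<le> (INF f\<in>{f\<in>F_sic. f t > 0}. 1 / f t * (\<integral>\<omega>. f (T \<omega>) \<partial>N) ^ n)"
proof (rule cINF_greatest)
  show "{f\<in>F_sic. f t > 0} \<noteq> {}" using const_1_in_F_sic by auto
next
  fix f assume "f \<in> {f\<in>F_sic. f t > 0}"
  then have f: "f \<in> F_sic" "f t > 0" by auto
  interpret M: prob_space M by fact
  interpret N: prob_space N by fact
  have m: "m > 0" using assms(2) by simp
  let ?E = "\<lambda>i j. \<integral>\<omega>. Bernstein m j (X i \<omega>) \<partial>M"
  have prob_T: "N.prob {\<omega>\<in>space N. T \<omega> = real j / real m} = 1 / real n * (\<Sum>i=1..n. ?E i j)"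
    if "j \<le> m" for j
    using assms(12) that by (simp add: Bernstein_def mult.assoc)
  have "N.expectation (\<lambda>\<omega>. f (T \<omega>)) =
      (\<Sum>j\<in>{0..m}. f (real j / real m) * N.prob {\<omega>\<in>space N. T \<omega> = real j / real m})"
    by (rule N.expectation_finite_range[OF assms(10)]) (use assms(11) m in \<open>auto simp: inj_on_def\<close>)
  also have "\<dots> = (\<Sum>j\<le>m. \<Sum>i=1..n. f (real j / real m) * ?E i j) / real n"
    by (simp add: prob_T atMost_atLeast0 sum_distrib_left sum_divide_distrib)
  also have "\<dots> = (\<Sum>i=1..n. \<Sum>j\<le>m. f (real j / real m) * ?E i j) / real n"
    by (subst sum.swap) simp
  finally have ET: "N.expectation (\<lambda>\<omega>. f (T \<omega>)) =
    (\<Sum>i=1..n. \<Sum>j\<le>m. f (real j / real m) * ?E i j) / real n" .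
  have "AE \<omega> in M. 0 \<le> X i \<omega> \<and> X i \<omega> \<le> 1" if "i \<in> {1..n}" for i
    using assms(7) that by (auto simp: moment_class_def)
  from M.tail_le_Bernstein_mean_power[OF _ _ assms(6) this f(1) _ f(2) m] assms(1,8)
  show "measure M {\<omega>\<in>space M. (\<Sum>i=1..n. X i \<omega>) \<ge> t} \<le> 1 / f t * (\<integral>\<omega>. f (T \<omega>) \<partial>N) ^ n"
    unfolding ET by simp
qed

end
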